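(* Let $p$ be an odd prime and write $p-1 = 2^s\prod_{j=1}^k q_j^{\alpha_j}$, where $s\ge 1$, $k\ge 0$, the $q_j$ are distinct odd primes and $\alpha_j\ge 1$ (empty products are $1$). Then for every generator $g$ of $\mathbb{Z}_p^*$, $$|\mathcal{M}(g)| = \frac{p-1}{2\prod_{j=1}^k q_j}\Big[ \prod_{j=1}^k (q_j-1) - 2\prod_{j=1}^k (q_j-2) + \prod_{j=1}^k (q_j-3) \Big],$$ $$|\mathcal{NI}(g)| = \frac{p-1}{2\prod_{j=1}^k q_j}\Big[ \prod_{j=1}^k q_j - 2\prod_{j=1}^k (q_j-1) + \prod_{j=1}^k (q_j-2) \Big].$$
   Context: For an odd prime $p$, $\mathbb{Z}_p^*$ is the multiplicative group of nonzero residues mod $p$. Let $\mathcal{G}$ be the set of generators (primitive roots) of $\mathbb{Z}_p^*$, $\mathcal{R}$ the set of quadratic residues in $\mathbb{Z}_p^*$, and $\mathcal{NG}$ the set of quadratic non-residues that are not generators. For $g\in\mathcal{G}$ define $\mathcal{R}_g=\{r\in\mathcal{R}: gr\in\mathcal{G}\}$, $\bar{\mathcal{R}}_g=\{r\in\mathcal{R}: gr\in\mathcal{NG}\}$, $\mathcal{I}(g)=\mathcal{R}_g\cap\mathcal{R}_{g^{-1}}$, $\mathcal{NI}(g)=\bar{\mathcal{R}}_g\cap\bar{\mathcal{R}}_{g^{-1}}$, and the set of missing generators $\mathcal{M}(g)=\mathcal{G}\setminus\{gr,\ g^{-1}r : r\in\mathcal{I}(g)\}$ (all products mod $p$). *)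

theory Defs
  imports "HOL-Number_Theory.Number_Theory" "HOL-Algebra.Multiplicative_Group"
begin

text \<open>
  The multiplicative group of nonzero residues modulo \<open>p\<close>; the elements are represented by
  the integers \<open>1, \<dots>, p - 1\<close>, and products and inverses are those of the group.
\<close>

abbreviation Zstar :: "nat \<Rightarrow> int monoid" where
  "Zstar p \<equiv> mult_of (residue_ring (int p))"

definition Gens :: "nat \<Rightarrow> int set" where
  "Gens p = {g \<in> carrier (Zstar p). generate (Zstar p) {g} = carrier (Zstar p)}"

definition QRes :: "nat \<Rightarrow> int set" where
  "QRes p = {r \<in> carrier (Zstar p). QuadRes (int p) r}"

definition NonGens :: "nat \<Rightarrow> int set" where
  "NonGens p = {x \<in> carrier (Zstar p). \<not> QuadRes (int p) x \<and> x \<notin> Gens p}"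

text \<open>
  \<open>R_gen p g\<close> and \<open>R_nongen p g\<close> are \<open>\<R>\<^sub>g\<close> and its barred version.
\<close>

definition R_gen :: "nat \<Rightarrow> int \<Rightarrow> int set" where
  "R_gen p g = {r \<in> QRes p. g \<otimes>\<^bsub>Zstar p\<^esub> r \<in> Gens p}"

definition R_nongen :: "nat \<Rightarrow> int \<Rightarrow> int set" where
  "R_nongen p g = {r \<in> QRes p. g \<otimes>\<^bsub>Zstar p\<^esub> r \<in> NonGens p}"

definition I_set :: "nat \<Rightarrow> int \<Rightarrow> int set" where
  "I_set p g = R_gen p g \<inter> R_gen p (inv\<^bsub>Zstar p\<^esub> g)"

definition NI_set :: "nat \<Rightarrow> int \<Rightarrow> int set" where
  "NI_set p g = R_nongen p g \<inter> R_nongen p (inv\<^bsub>Zstar p\<^esub> g)"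

definition missing_gens :: "nat \<Rightarrow> int \<Rightarrow> int set" where
  "missing_gens p g = Gens p -
     ({g \<otimes>\<^bsub>Zstar p\<^esub> r | r. r \<in> I_set p g} \<union>
      {inv\<^bsub>Zstar p\<^esub> g \<otimes>\<^bsub>Zstar p\<^esub> r | r. r \<in> I_set p g})"

end

theory Submission
  imports Defs
begin

text \<open>
  Taking logarithms to base \<open>g\<close> identifies the group with the integers modulo \<open>N = p - 1\<close>:
  residues become even exponents and generators become exponents coprime to \<open>N\<close>.
  The missing generators are then the units \<open>a\<close> for which neither \<open>a - 2\<close> nor \<open>a + 2\<close> is a unit,
  and, after shifting exponents by one, \<open>\<N>\<I>(g)\<close> becomes the set of odd \<open>a\<close> for which neither
  \<open>a\<close> nor \<open>a - 2\<close> is a unit.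
  By inclusion-exclusion it remains to count the odd \<open>a\<close> such that \<open>a + s\<close> is a unit for every
  \<open>s\<close> in a given subset \<open>S\<close> of \<open>{-2, 0, 2}\<close>. For each odd prime \<open>q\<close> dividing \<open>N\<close> this excludes
  exactly \<open>card S\<close> classes modulo \<open>q\<close>, so the Chinese remainder theorem gives the product of
  the factors \<open>q - card S\<close>.
\<close>

section \<open>Counting residues that satisfy local conditions\<close>

text \<open>By the Chinese remainder theorem, sending \<open>x\<close> to the family of its residues
  is a bijection onto the product of the local solution sets.\<close>

lemma card_residue_conditions:
  fixes m :: "'i \<Rightarrow> nat" and P :: "'i \<Rightarrow> nat \<Rightarrow> bool"
  assumes fin: "finite I" and nz: "\<forall>i\<in>I. m i \<noteq> 0"
    and cop: "\<forall>i\<in>I. \<forall>j\<in>I. i \<noteq> j \<longrightarrow> coprime (m i) (m j)"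
  shows "card {x. x < (\<Prod>i\<in>I. m i) \<and> (\<forall>i\<in>I. P i (x mod m i))} = (\<Prod>i\<in>I. card {x. x < m i \<and> P i x})"
proof -
  let ?A = "{x. x < (\<Prod>i\<in>I. m i) \<and> (\<forall>i\<in>I. P i (x mod m i))}"
  let ?f = "\<lambda>x. \<lambda>i\<in>I. x mod m i"
  have "bij_betw ?f ?A (\<Pi>\<^sub>E i\<in>I. {x. x < m i \<and> P i x})"
  proof (rule bij_betw_imageI)
    show "inj_on ?f ?A"
    proof (rule inj_onI)
      fix x y assume x: "x \<in> ?A" and y: "y \<in> ?A" and eq: "?f x = ?f y"
      have "\<forall>i\<in>I. [y = x] (mod m i)"
        using eq unfolding cong_def by (metis restrict_apply')
      \<comment> \<open>Uniqueness is invoked for the system whose prescribed residues are those of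
        \<open>x\<close> itself; both \<open>x\<close> and \<open>y\<close> solve it.\<close>
      then show "x = y"
        using chinese_remainder_unique_nat[OF fin nz cop, of "\<lambda>_. x"] x y by auto
    qed
    show "?f ` ?A = (\<Pi>\<^sub>E i\<in>I. {x. x < m i \<and> P i x})"
    proof
      show "?f ` ?A \<subseteq> (\<Pi>\<^sub>E i\<in>I. {x. x < m i \<and> P i x})"
        using nz by auto
      show "(\<Pi>\<^sub>E i\<in>I. {x. x < m i \<and> P i x}) \<subseteq> ?f ` ?A"
      proof
        fix u assume u: "u \<in> (\<Pi>\<^sub>E i\<in>I. {x. x < m i \<and> P i x})"
        obtain x where x: "x < (\<Prod>i\<in>I. m i)" "\<forall>i\<in>I. [x = u i] (mod m i)"
          using chinese_remainder_unique_nat[OF fin nz cop, of u] by auto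
        have mod: "x mod m i = u i" "P i (u i)" if "i \<in> I" for i
          using x(2) u that by (auto simp: cong_def PiE_def Pi_def)
        have "u = ?f x"
          using mod u by (auto simp: PiE_def extensional_def fun_eq_iff)
        then show "u \<in> ?f ` ?A"
          using x(1) mod by auto
      qed
    qed
  qed
  then show ?thesis
    using bij_betw_same_card[of ?f ?A] by (simp add: card_PiE[OF fin])
qed

text \<open>Each of the \<open>c\<close> blocks of length \<open>M\<close> is a translate of the
  first. This passes from the radical of \<open>p - 1\<close> to \<open>p - 1\<close>
  itself.\<close>

lemma card_periodic:
  fixes M c :: nat and P :: "nat \<Rightarrow> bool"
  assumes per: "\<And>x. P (x + M) = P x"
  shows "card {x. x < c * M \<and> P x} = c * card {x. x < M \<and> P x}"
proof (induction c)
  case (Suc c)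
  have shift: "P (x + c * M) = P x" for c x
  proof (induction c)
    case (Suc c)
    then show ?case using per[of "x + c * M"] by (simp add: ac_simps)
  qed simp
  have "{x. x < Suc c * M \<and> P x} = {x. x < c * M \<and> P x} \<union> (\<lambda>x. x + c * M) ` {x. x < M \<and> P x}"
    (is "?L = ?A \<union> ?B")
  proof
    show "?L \<subseteq> ?A \<union> ?B"
    proof
      fix x assume x: "x \<in> ?L"
      show "x \<in> ?A \<union> ?B"
      proof (cases "x < c * M")
        case False
        then have "x = (x - c * M) + c * M" "x - c * M < M"
          using x by auto
        then have "x \<in> ?B"
          using x shift[of "x - c * M" c] by (intro image_eqI[of _ _ "x - c * M"]) auto
        then show ?thesis by blast
      qed (use x in auto)
    qed
    show "?A \<union> ?B \<subseteq> ?L"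
      using shift by auto
  qed
  moreover have "card (?A \<union> ?B) = card ?A + card ?B"
    by (intro card_Un_disjoint) auto
  moreover have "card ?B = card {x. x < M \<and> P x}"
    by (intro card_image) auto
  ultimately show ?case
    using Suc.IH by simp
qed simp

text \<open>Each \<open>s\<close> forbids the single class of \<open>- s\<close>, and
  \<open>inj\<close> makes these classes distinct. They all fit below \<open>q\<close>, so the real
  difference agrees with the natural one.\<close>

lemma card_residues_avoiding:
  fixes q :: nat and S :: "int set"
  assumes "q > 0" and "finite S"
    and inj: "\<And>s t. s \<in> S \<Longrightarrow> t \<in> S \<Longrightarrow> int q dvd s - t \<Longrightarrow> s = t"
  shows "real (card {x. x < q \<and> (\<forall>s\<in>S. \<not> int q dvd int x + s)}) = real q - real (card S)"
proof -
  let ?h = "\<lambda>s. nat ((- s) mod int q)"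
  have h: "int (?h s) = (- s) mod int q" for s
    using \<open>q > 0\<close> by simp
  have lt: "?h s < q" for s
    using \<open>q > 0\<close> by (metis h of_nat_0_less_iff of_nat_less_iff pos_mod_bound)
  have root: "x = ?h s \<longleftrightarrow> int q dvd int x + s" if "x < q" for x s
  proof -
    have "x = ?h s \<longleftrightarrow> int x mod int q = (- s) mod int q"
      using that h[of s] by (metis mod_pos_pos_trivial of_nat_0_le_iff of_nat_eq_iff of_nat_less_iff)
    then show ?thesis
      by (simp add: mod_eq_dvd_iff)
  qed
  have "inj_on ?h S"
  proof (rule inj_onI)
    fix s t assume "s \<in> S" "t \<in> S" "?h s = ?h t"
    then have "(- t) mod int q = (- s) mod int q"
      using h by metis
    then have "int q dvd s - t"
      by (simp add: mod_eq_dvd_iff)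
    then show "s = t"
      using inj \<open>s \<in> S\<close> \<open>t \<in> S\<close> by blast
  qed
  then have card: "card (?h ` S) = card S"
    by (rule card_image)
  have sub: "?h ` S \<subseteq> {..<q}"
    using lt by auto
  have "{x. x < q \<and> (\<forall>s\<in>S. \<not> int q dvd int x + s)} = {..<q} - ?h ` S"
    using root by auto
  then have "card {x. x < q \<and> (\<forall>s\<in>S. \<not> int q dvd int x + s)} = q - card S"
    using card sub \<open>finite S\<close> by (simp add: card_Diff_subset)
  moreover have "card S \<le> q"
    using card card_mono[OF _ sub] by simp
  ultimately show ?thesis
    by simp
qed

text \<open>Coprimality to a product is coprimality to each factor, and for a prime power it is
  non-divisibility by the prime. The factor \<open>2 ^ s\<close> contributes oddness because
  \<open>s \<ge> 1\<close>.\<close>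

lemma coprime_iff_not_dvd_primes:
  fixes q \<alpha> :: "'i \<Rightarrow> nat" and x :: int and s :: nat
  assumes "finite J" and "s \<ge> 1" and "\<And>j. j \<in> J \<Longrightarrow> prime (q j) \<and> \<alpha> j \<ge> 1"
  shows "coprime x (int (2 ^ s * (\<Prod>j\<in>J. q j ^ \<alpha> j))) \<longleftrightarrow> odd x \<and> (\<forall>j\<in>J. \<not> int (q j) dvd x)"
proof -
  have prime_cop: "coprime x (int r) \<longleftrightarrow> \<not> int r dvd x" if "prime r" for r
    using that by (metis coprime_absorb_right coprime_commute not_prime_unit prime_imp_coprime
        prime_nat_int_transfer)
  have "coprime x (\<Prod>j\<in>J. int (q j) ^ \<alpha> j) \<longleftrightarrow> (\<forall>j\<in>J. coprime x (int (q j) ^ \<alpha> j))"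
    using \<open>finite J\<close> by (induction J rule: finite_induct) auto
  also have "\<dots> \<longleftrightarrow> (\<forall>j\<in>J. \<not> int (q j) dvd x)"
    using assms(3) prime_cop by (metis coprime_power_right_iff not_one_le_zero)
  finally show ?thesis
    using \<open>s \<ge> 1\<close> by (auto simp: coprime_commute)
qed

text \<open>The conditions only involve divisibility by 2 and by the \<open>q j\<close>, so they
  have period \<open>2 * (\<Prod>j\<in>J. q j)\<close>. One period is counted prime by prime, then
  repeated.\<close>

lemma card_odd_all_coprime:
  fixes q \<alpha> :: "'i \<Rightarrow> nat" and s N :: nat and S :: "int set"
  assumes J: "finite J" and N: "N = 2 ^ s * (\<Prod>j\<in>J. q j ^ \<alpha> j)" and s: "s \<ge> 1"
    and q: "\<And>j. j \<in> J \<Longrightarrow> prime (q j) \<and> odd (q j) \<and> \<alpha> j \<ge> 1"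
    and inj: "inj_on q J" and S: "S \<subseteq> {-2, 0, 2}"
  shows "real (card {a. a < N \<and> odd a \<and> (\<forall>t\<in>S. coprime (int a + t) (int N))})
    = real N / (2 * (\<Prod>j\<in>J. real (q j))) * (\<Prod>j\<in>J. real (q j) - real (card S))"
proof -
  \<comment> \<open>\<open>M\<close> is the radical of \<open>N\<close>, and \<open>c\<close> is the
    number of periods of length \<open>M\<close> below \<open>N\<close>.\<close>
  define M where "M = 2 * (\<Prod>j\<in>J. q j)"
  define c where "c = 2 ^ (s - 1) * (\<Prod>j\<in>J. q j ^ (\<alpha> j - 1))"
  define P where "P a \<longleftrightarrow> odd a \<and> (\<forall>j\<in>J. \<forall>t\<in>S. \<not> int (q j) dvd int a + t)" for a :: nat
  have "(\<Prod>j\<in>J. q j ^ \<alpha> j) = (\<Prod>j\<in>J. q j ^ (\<alpha> j - 1) * q j)"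
    using q by (intro prod.cong refl power_minus_mult[symmetric]) (auto simp: Suc_le_eq)
  moreover have "(2::nat) ^ s = 2 ^ (s - 1) * 2"
    using s by (intro power_minus_mult[symmetric]) simp
  ultimately have NcM: "N = c * M"
    unfolding N M_def c_def by (simp add: prod.distrib)
  have finS: "finite S"
    using S finite_subset by blast
  \<comment> \<open>Even shifts preserve parity, so oddness of \<open>a + t\<close> is oddness of
    \<open>a\<close>; for empty \<open>S\<close> oddness comes from the explicit conjunct.\<close>
  have evenS: "even t" if "t \<in> S" for t
    using S that by auto
  have P_iff: "odd a \<and> (\<forall>t\<in>S. coprime (int a + t) (int N)) \<longleftrightarrow> P a" for a
  proof -
    have "coprime (int a + t) (int N) \<longleftrightarrow> odd (int a + t) \<and> (\<forall>j\<in>J. \<not> int (q j) dvd int a + t)" for t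
      unfolding N using q by (intro coprime_iff_not_dvd_primes[OF J s]) auto
    then show ?thesis
      using evenS unfolding P_def by auto
  qed
  have per: "P (a + M) = P a" for a
  proof -
    have "int (q j) dvd int (a + M) + t \<longleftrightarrow> int (q j) dvd int a + t" if "j \<in> J" for j t
    proof -
      have "int (q j) dvd int M"
        unfolding M_def using J that by (simp del: of_nat_prod of_nat_mult add: dvd_prodI dvd_mult)
      then have "int (q j) dvd (int a + t) + int M \<longleftrightarrow> int (q j) dvd int a + t"
        by (rule dvd_add_left_iff)
      then show ?thesis by (simp add: ac_simps)
    qed
    then show ?thesis
      unfolding P_def by (auto simp: M_def)
  qed
  \<comment> \<open>The index \<open>None\<close> carries the modulus 2 with the parity condition,
    and \<open>Some j\<close> carries the modulus \<open>q j\<close>.\<close>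
  let ?I = "insert None (Some ` J)"
  let ?m = "\<lambda>i. case i of None \<Rightarrow> 2 | Some j \<Rightarrow> q j"
  let ?P = "\<lambda>i x. case i of None \<Rightarrow> odd x | Some j \<Rightarrow> \<forall>t\<in>S. \<not> int (q j) dvd int x + t"
  have prodI: "(\<Prod>i\<in>?I. f i) = f None * (\<Prod>j\<in>J. f (Some j))" for f :: "'i option \<Rightarrow> nat"
    using J by (subst prod.insert) (auto simp: prod.reindex)
  have "int (q j) dvd int (x mod q j) + t \<longleftrightarrow> int (q j) dvd int x + t" for j x t
    by (simp add: dvd_eq_mod_eq_0 of_nat_mod mod_add_left_eq)
  then have "{x. x < M \<and> P x} = {x. x < (\<Prod>i\<in>?I. ?m i) \<and> (\<forall>i\<in>?I. ?P i (x mod ?m i))}"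
    unfolding prodI M_def P_def by auto
  moreover have "card {x. x < (\<Prod>i\<in>?I. ?m i) \<and> (\<forall>i\<in>?I. ?P i (x mod ?m i))}
    = (\<Prod>i\<in>?I. card {x. x < ?m i \<and> ?P i x})"
  proof (rule card_residue_conditions)
    show "\<forall>i\<in>?I. ?m i \<noteq> 0"
      using q by (auto dest: prime_gt_0_nat)
    have "coprime (q j) (q j')" if "j \<in> J" "j' \<in> J" "j \<noteq> j'" for j j'
      using that q inj by (intro primes_coprime) (auto dest: inj_onD)
    then show "\<forall>i\<in>?I. \<forall>j\<in>?I. i \<noteq> j \<longrightarrow> coprime (?m i) (?m j)"
      using q by auto
  qed (use J in simp)
  \<comment> \<open>The modulus 2 thus contributes a factor 1.\<close>
  moreover have "{x. x < (2::nat) \<and> odd x} = {1}"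
    by (auto simp: less_2_cases_iff)
  ultimately have cardM: "card {x. x < M \<and> P x}
    = (\<Prod>j\<in>J. card {x. x < q j \<and> (\<forall>t\<in>S. \<not> int (q j) dvd int x + t)})"
    by (simp add: prodI)
  have "real (card {x. x < q j \<and> (\<forall>t\<in>S. \<not> int (q j) dvd int x + t)}) = real (q j) - real (card S)"
    if "j \<in> J" for j
  proof (rule card_residues_avoiding[OF _ finS])
    show "q j > 0" using q that prime_gt_0_nat by blast
    fix u v assume uv: "u \<in> S" "v \<in> S" "int (q j) dvd u - v"
    have "u \<in> {-2, 0, 2}" "v \<in> {-2, 0, 2}"
      using S uv by blast+
    then have "u - v \<in> {-4, -2, 0, 2, 4}"
      by auto
    \<comment> \<open>Every nonzero difference of shifts divides 4, so an odd prime cannot divide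
      it. This covers \<open>q j = 3\<close> too, where three shifts exhaust all classes.\<close>
    moreover have "\<not> int (q j) dvd d" if "d \<in> {-4, -2, 2, 4}" for d
    proof
      assume "int (q j) dvd d"
      moreover have "d dvd 2 ^ 2"
        using that by auto
      ultimately have "int (q j) dvd 2 ^ 2"
        by (rule dvd_trans)
      then have "q j dvd 2 ^ 2"
        by (metis int_dvd_int_iff of_nat_numeral of_nat_power)
      then have "q j = 2"
        using q[OF \<open>j \<in> J\<close>] by (meson prime_dvd_power primes_dvd_imp_eq two_is_prime_nat)
      then show False
        using q[OF \<open>j \<in> J\<close>] by simp
    qed
    ultimately have "u - v = 0"
      using uv(3) by blast
    then show "u = v"
      by simp
  qed
  then have "real (card {x. x < M \<and> P x}) = (\<Prod>j\<in>J. real (q j) - real (card S))"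
    unfolding cardM of_nat_prod by (intro prod.cong) auto
  moreover have "real c = real N / real M"
    using NcM q prime_gt_0_nat J unfolding M_def by (auto simp: field_simps)
  ultimately show ?thesis
    unfolding P_iff using card_periodic[of P M c, OF per] NcM by (simp add: M_def)
qed

text \<open>Sum the indicator identity (1 - P)(1 - Q) = 1 - P - Q + PQ over
  \<open>X\<close>.\<close>

lemma card_neither:
  assumes "finite X"
  shows "real (card {x \<in> X. \<not> P x \<and> \<not> Q x})
    = real (card X) - real (card {x \<in> X. P x}) - real (card {x \<in> X. Q x}) + real (card {x \<in> X. P x \<and> Q x})"
proof -
  have "real (card {x \<in> X. R x}) = (\<Sum>x\<in>X. of_bool (R x))" for R
    using assms by (simp add: Int_def)
  moreover have "real (card X) = (\<Sum>x\<in>X. 1)"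
    by simp
  ultimately show ?thesis
    by (simp only: sum_subtractf[symmetric] sum.distrib[symmetric]) (intro sum.cong, auto)
qed

section \<open>Powers of a generator of a cyclic group\<close>

text \<open>The power generates the group exactly when \<open>g\<close> is one of its powers, that
  is, when \<open>i\<close> is invertible modulo \<open>ord g\<close>.\<close>

lemma (in group) generate_pow_eq_carrier_iff:
  fixes i :: int
  assumes "g \<in> carrier G" and gen: "generate G {g} = carrier G"
  shows "generate G {g [^] i} = carrier G \<longleftrightarrow> coprime i (int (ord g))"
proof -
  have gi: "generate G {g [^] i} = {g [^] (i * k) | k. k \<in> (UNIV :: int set)}"
    using assms by (simp add: generate_pow int_pow_pow)
  have "generate G {g [^] i} = carrier G \<longleftrightarrow> g \<in> generate G {g [^] i}"
  proof
    assume "g \<in> generate G {g [^] i}"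
    then have "carrier G \<subseteq> generate G {g [^] i}"
      using assms generate_is_subgroup[of "{g [^] i}"] generate_subgroup_incl[of "{g}"] by auto
    then show "generate G {g [^] i} = carrier G"
      using assms generate_incl[of "{g [^] i}"] by auto
  qed (use assms in simp)
  also have "\<dots> \<longleftrightarrow> (\<exists>k. g [^] (i * k) = g [^] (1::int))"
    unfolding gi using assms by simp metis
  also have "\<dots> \<longleftrightarrow> (\<exists>k. [i * k = 1] (mod int (ord g)))"
    using assms by (simp only: int_pow_eq cong_iff_dvd_diff) (simp add: dvd_diff_commute)
  also have "\<dots> \<longleftrightarrow> coprime i (int (ord g))"
    by (metis coprime_iff_invertible_int)
  finally show ?thesis .
qed

text \<open>Any \<open>ord g\<close> consecutive exponents represent each class modulo
  \<open>ord g\<close> once; \<open>c\<close> sets where this window begins.\<close>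

lemma (in group) bij_betw_shifted_powers:
  fixes c :: int
  assumes g: "g \<in> carrier G" and gen: "generate G {g} = carrier G" and "finite (carrier G)"
  shows "bij_betw (\<lambda>a. g [^] (int a + c)) {..<ord g} (carrier G)"
proof (rule bij_betw_imageI)
  show "inj_on (\<lambda>a. g [^] (int a + c)) {..<ord g}"
  proof (rule inj_onI)
    fix a b assume ab: "a \<in> {..<ord g}" "b \<in> {..<ord g}" "g [^] (int a + c) = g [^] (int b + c)"
    then have "int (ord g) dvd int b - int a"
      using g by (simp add: int_pow_eq)
    then have "int b mod int (ord g) = int a mod int (ord g)"
      by (simp add: mod_eq_dvd_iff)
    then show "a = b"
      using ab by simp
  qed
  have "ord g > 0"
    using ord_ge_1[of g] assms by simp
  have "x \<in> (\<lambda>a. g [^] (int a + c)) ` {..<ord g}" if "x \<in> carrier G" for x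
  proof -
    obtain k :: int where k: "x = g [^] k"
      using \<open>x \<in> carrier G\<close> unfolding gen[symmetric] generate_pow[OF g] by blast
    let ?a = "nat ((k - c) mod int (ord g))"
    have a: "int ?a = (k - c) mod int (ord g)"
      using \<open>ord g > 0\<close> by simp
    have "int (ord g) dvd (k - c) - int ?a"
      unfolding a by (rule dvd_minus_mod)
    then have "g [^] (int ?a + c) = x"
      unfolding k using g by (simp add: int_pow_eq algebra_simps)
    moreover have "?a < ord g"
      using a \<open>ord g > 0\<close> by (metis of_nat_0_less_iff of_nat_less_iff pos_mod_bound)
    ultimately show ?thesis by blast
  qed
  then show "(\<lambda>a. g [^] (int a + c)) ` {..<ord g} = carrier G"
    using g by auto
qed

text \<open>Turns the size of a set of group elements into a count of exponents, with a freely
  chosen shift \<open>c\<close>.\<close>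

lemma (in group) card_via_powers:
  fixes c :: int
  assumes "g \<in> carrier G" and "generate G {g} = carrier G" and "finite (carrier G)"
    and "Y \<subseteq> carrier G" and mem: "\<And>i::int. g [^] i \<in> Y \<longleftrightarrow> R i"
  shows "card Y = card {a. a < ord g \<and> R (int a + c)}"
proof -
  let ?h = "\<lambda>a. g [^] (int a + c)"
  have bij: "bij_betw ?h {..<ord g} (carrier G)"
    using assms(1-3) by (rule bij_betw_shifted_powers)
  have "?h ` {a. a < ord g \<and> R (int a + c)} = Y"
  proof
    show "?h ` {a. a < ord g \<and> R (int a + c)} \<subseteq> Y"
      using mem by auto
    show "Y \<subseteq> ?h ` {a. a < ord g \<and> R (int a + c)}"
    proof
      fix y assume "y \<in> Y"
      then obtain a where "a < ord g" "y = ?h a"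
        using bij \<open>Y \<subseteq> carrier G\<close> unfolding bij_betw_def by blast
      then show "y \<in> ?h ` {a. a < ord g \<and> R (int a + c)}"
        using \<open>y \<in> Y\<close> mem by auto
    qed
  qed
  moreover have "inj_on ?h {a. a < ord g \<and> R (int a + c)}"
    using bij by (auto simp: bij_betw_def intro: inj_on_subset)
  then have "card (?h ` {a. a < ord g \<and> R (int a + c)}) = card {a. a < ord g \<and> R (int a + c)}"
    by (rule card_image)
  ultimately show ?thesis
    by simp
qed

section \<open>Discrete logarithms modulo \<open>p\<close>\<close>

locale primitive_root =
  fixes p :: nat and g :: int
  assumes p_prime: "prime p" and p_odd: "odd p" and g_gen: "g \<in> Gens p"
begin

sublocale residues_prime p "residue_ring (int p)"
  by unfold_locales (fact p_prime)

sublocale Zp: group "Zstar p"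
  by (rule field_mult_group)

abbreviation gpow :: "int \<Rightarrow> int" where
  "gpow i \<equiv> g [^]\<^bsub>Zstar p\<^esub> i"

lemma carrier_eq: "carrier (Zstar p) = {1..int p - 1}"
  by (auto simp: res_carrier_eq zero_cong)

lemma mult_eq: "x \<otimes>\<^bsub>Zstar p\<^esub> y = (x * y) mod int p"
  by (simp add: res_mult_eq)

lemma finite_carrier: "finite (carrier (Zstar p))"
  unfolding carrier_eq by simp

lemma g_carrier: "g \<in> carrier (Zstar p)" and generate_g: "generate (Zstar p) {g} = carrier (Zstar p)"
  using g_gen unfolding Gens_def by auto

lemma ord_g: "Zp.ord g = p - 1"
proof -
  have "Zp.ord g = card (carrier (Zstar p))"
    using Zp.generate_pow_card[OF g_carrier] generate_g by simp
  then show ?thesis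
    unfolding carrier_eq by (simp add: nat_diff_distrib)
qed

lemma gpow_carrier: "gpow i \<in> carrier (Zstar p)"
  using g_carrier by (rule Zp.int_pow_closed)

lemma gpow_cases:
  assumes "x \<in> carrier (Zstar p)"
  obtains i where "x = gpow i"
  using assms Zp.generate_pow[OF g_carrier] generate_g by auto

lemma gpow_eq_iff: "gpow i = gpow j \<longleftrightarrow> int (p - 1) dvd j - i"
  using Zp.int_pow_eq[OF g_carrier] ord_g by simp

lemma gpow_add: "gpow i \<otimes>\<^bsub>Zstar p\<^esub> gpow j = gpow (i + j)"
  using Zp.int_pow_mult[OF g_carrier] by simp

lemma g_mult_gpow: "g \<otimes>\<^bsub>Zstar p\<^esub> gpow i = gpow (i + 1)"
  using gpow_add[of 1 i] g_carrier by (simp del: carrier_mult_of mult_mult_of add: add.commute)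

lemma inv_g_mult_gpow: "inv\<^bsub>Zstar p\<^esub> g \<otimes>\<^bsub>Zstar p\<^esub> gpow i = gpow (i - 1)"
  using gpow_add[of "-1" i] g_carrier Zp.int_pow_neg[OF g_carrier, of 1]
  by (simp del: carrier_mult_of mult_mult_of)

definition unit_exp :: "int \<Rightarrow> bool" where
  "unit_exp i \<longleftrightarrow> coprime i (int (p - 1))"

lemma gpow_in_Gens_iff: "gpow i \<in> Gens p \<longleftrightarrow> unit_exp i"
  using Zp.generate_pow_eq_carrier_iff[OF g_carrier generate_g] gpow_carrier ord_g
  unfolding Gens_def unit_exp_def by simp

lemma unit_exp_imp_odd: "unit_exp i \<Longrightarrow> odd i"
  using p_odd coprime_common_divisor[of i "int (p - 1)" 2] unfolding unit_exp_def by auto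

text \<open>A square root of \<open>gpow i\<close> is some \<open>gpow j\<close>, so
  \<open>i\<close> and \<open>j + j\<close> agree modulo the even number \<open>p - 1\<close> and
  have the same parity.\<close>

lemma QuadRes_gpow_iff: "QuadRes (int p) (gpow i) \<longleftrightarrow> even i"
proof
  assume "QuadRes (int p) (gpow i)"
  then obtain y where y: "[y ^ 2 = gpow i] (mod int p)"
    unfolding QuadRes_def by auto
  have range: "1 \<le> gpow i" "gpow i < int p"
    using gpow_carrier[of i] unfolding carrier_eq by auto
  \<comment> \<open>The root \<open>y\<close> is an arbitrary integer; its residue must be shown
    nonzero before it can be written as a power of \<open>g\<close>.\<close>
  have "y mod int p \<noteq> 0"
  proof
    assume "y mod int p = 0"
    then have "y ^ 2 mod int p = 0"
      by (simp add: power2_eq_square mod_eq_0_iff_dvd)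
    then show False
      using y range by (simp add: cong_def)
  qed
  moreover have "0 \<le> y mod int p" "y mod int p < int p"
    using m_gt_one by auto
  ultimately have "y mod int p \<in> carrier (Zstar p)"
    unfolding carrier_eq by auto
  then obtain j where j: "y mod int p = gpow j"
    by (rule gpow_cases)
  have "gpow (j + j) = (y mod int p * (y mod int p)) mod int p"
    using gpow_add[of j j] mult_eq j by metis
  also have "\<dots> = gpow i"
    using y range by (simp add: cong_def power2_eq_square mod_mult_eq)
  finally have "int (p - 1) dvd i - (j + j)"
    by (simp add: gpow_eq_iff)
  moreover have "even (int (p - 1))"
    using p_odd by simp
  ultimately have "even (i - (j + j))"
    by (rule dvd_trans[rotated])
  then show "even i"
    by simp
next
  assume "even i"
  then obtain j where "i = j + j"
    by (metis evenE mult_2)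
  then have "gpow i = (gpow j * gpow j) mod int p"
    using gpow_add[of j j] mult_eq by metis
  then show "QuadRes (int p) (gpow i)"
    unfolding QuadRes_def cong_def by (metis mod_mod_trivial power2_eq_square)
qed

lemma gpow_in_QRes_iff: "gpow i \<in> QRes p \<longleftrightarrow> even i"
  unfolding QRes_def using gpow_carrier QuadRes_gpow_iff by simp

lemma gpow_in_NonGens_iff: "gpow i \<in> NonGens p \<longleftrightarrow> odd i \<and> \<not> unit_exp i"
  unfolding NonGens_def using gpow_carrier QuadRes_gpow_iff gpow_in_Gens_iff by simp

text \<open>Unit exponents are odd, so \<open>unit_exp (i + 1)\<close> already forces the evenness
  of \<open>i\<close> that membership in \<open>QRes p\<close> demands.\<close>

lemma gpow_in_I_set_iff:
  "gpow i \<in> I_set p g \<longleftrightarrow> unit_exp (i + 1) \<and> unit_exp (i - 1)"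
  unfolding I_set_def R_gen_def
  by (auto simp: g_mult_gpow inv_g_mult_gpow gpow_in_QRes_iff gpow_in_Gens_iff
      simp del: mult_mult_of dest: unit_exp_imp_odd)

text \<open>For even \<open>i\<close> both neighbours are odd, so their powers are non-residues, and
  lying in \<open>NonGens p\<close> reduces to not being a generator.\<close>

lemma gpow_in_NI_set_iff:
  "gpow i \<in> NI_set p g \<longleftrightarrow> even i \<and> \<not> unit_exp (i + 1) \<and> \<not> unit_exp (i - 1)"
  unfolding NI_set_def R_nongen_def
  by (auto simp: g_mult_gpow inv_g_mult_gpow gpow_in_QRes_iff gpow_in_NonGens_iff
      simp del: mult_mult_of)

lemma I_set_carrier: "I_set p g \<subseteq> carrier (Zstar p)"
  unfolding I_set_def R_gen_def QRes_def by auto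

lemma NI_set_carrier: "NI_set p g \<subseteq> carrier (Zstar p)"
  unfolding NI_set_def R_nongen_def QRes_def by auto

lemma missing_gens_carrier: "missing_gens p g \<subseteq> carrier (Zstar p)"
  unfolding missing_gens_def Gens_def by auto

text \<open>Multiplication by \<open>u\<close> shifts exponents by \<open>d\<close> and can be
  cancelled. It serves \<open>g\<close> with \<open>d = 1\<close> and the inverse of
  \<open>g\<close> with \<open>d = -1\<close>.\<close>

lemma gpow_in_translate_iff:
  assumes "\<And>i. u \<otimes>\<^bsub>Zstar p\<^esub> gpow i = gpow (i + d)" and "u \<in> carrier (Zstar p)"
    and "A \<subseteq> carrier (Zstar p)"
  shows "gpow i \<in> {u \<otimes>\<^bsub>Zstar p\<^esub> r | r. r \<in> A} \<longleftrightarrow> gpow (i - d) \<in> A"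
proof
  assume "gpow i \<in> {u \<otimes>\<^bsub>Zstar p\<^esub> r | r. r \<in> A}"
  then obtain r where r: "r \<in> A" "gpow i = u \<otimes>\<^bsub>Zstar p\<^esub> r"
    by blast
  then have "u \<otimes>\<^bsub>Zstar p\<^esub> gpow (i - d) = u \<otimes>\<^bsub>Zstar p\<^esub> r"
    using assms(1)[of "i - d"] by simp
  then have "gpow (i - d) = r"
    using Zp.Units_l_cancel assms(2,3) gpow_carrier r(1) Zp.Units_eq by blast
  then show "gpow (i - d) \<in> A"
    using r(1) by simp
next
  assume "gpow (i - d) \<in> A"
  moreover have "gpow i = u \<otimes>\<^bsub>Zstar p\<^esub> gpow (i - d)"
    using assms(1)[of "i - d"] by simp
  ultimately show "gpow i \<in> {u \<otimes>\<^bsub>Zstar p\<^esub> r | r. r \<in> A}"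
    by blast
qed

text \<open>The translate of \<open>I_set p g\<close> by \<open>g\<close> requires \<open>i\<close>
  and \<open>i - 2\<close> to be unit exponents, the one by the inverse \<open>i + 2\<close> and
  \<open>i\<close>.\<close>

lemma gpow_in_missing_gens_iff:
  "gpow i \<in> missing_gens p g \<longleftrightarrow>
    unit_exp i \<and> \<not> unit_exp (i - 2) \<and> \<not> unit_exp (i + 2)"
proof -
  have "gpow i \<in> {g \<otimes>\<^bsub>Zstar p\<^esub> r | r. r \<in> I_set p g} \<longleftrightarrow> gpow (i - 1) \<in> I_set p g"
    using g_mult_gpow g_carrier I_set_carrier by (rule gpow_in_translate_iff)
  moreover have "gpow i \<in> {inv\<^bsub>Zstar p\<^esub> g \<otimes>\<^bsub>Zstar p\<^esub> r | r. r \<in> I_set p g} \<longleftrightarrow> gpow (i - (-1)) \<in> I_set p g"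
    using inv_g_mult_gpow Zp.inv_closed[OF g_carrier] I_set_carrier
    by (intro gpow_in_translate_iff) simp_all
  ultimately show ?thesis
    unfolding missing_gens_def by (simp only: Diff_iff Un_iff gpow_in_I_set_iff gpow_in_Gens_iff) (auto simp: add.commute)
qed

lemma card_missing_gens:
  "card (missing_gens p g) = card {a. a < p - 1 \<and> unit_exp (int a) \<and>
    \<not> unit_exp (int a - 2) \<and> \<not> unit_exp (int a + 2)}"
  using Zp.card_via_powers[OF g_carrier generate_g finite_carrier missing_gens_carrier
      gpow_in_missing_gens_iff, of 0] ord_g by simp

text \<open>The window starts at \<open>-1\<close>: here \<open>a\<close> stands for the exponent
  \<open>a - 1\<close>, which turns even exponents into odd \<open>a\<close> and their neighbours
  into \<open>a\<close> and \<open>a - 2\<close>.\<close>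

lemma card_NI_set:
  "card (NI_set p g) = card {a. a < p - 1 \<and> odd a \<and>
    \<not> unit_exp (int a) \<and> \<not> unit_exp (int a - 2)}"
  using Zp.card_via_powers[OF g_carrier generate_g finite_carrier NI_set_carrier
      gpow_in_NI_set_iff, of "-1"] ord_g by simp

end

section \<open>Inclusion-exclusion for the two cardinalities\<close>

theorem theorem1p1:
  fixes p s k :: nat and q \<alpha> :: "nat \<Rightarrow> nat" and g :: int
  assumes "prime p" and "odd p"
    and "p - 1 = 2 ^ s * (\<Prod>j=1..k. q j ^ \<alpha> j)"
    and "s \<ge> 1"
    and "\<And>j. j \<in> {1..k} \<Longrightarrow> prime (q j) \<and> odd (q j) \<and> \<alpha> j \<ge> 1"
    and "inj_on q {1..k}"
    and "g \<in> Gens p"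
  shows "real (card (missing_gens p g)) =
           (real p - 1) / (2 * (\<Prod>j=1..k. real (q j))) *
           ((\<Prod>j=1..k. real (q j) - 1) - 2 * (\<Prod>j=1..k. real (q j) - 2)
             + (\<Prod>j=1..k. real (q j) - 3))
       \<and> real (card (NI_set p g)) =
           (real p - 1) / (2 * (\<Prod>j=1..k. real (q j))) *
           ((\<Prod>j=1..k. real (q j)) - 2 * (\<Prod>j=1..k. real (q j) - 1)
             + (\<Prod>j=1..k. real (q j) - 2))"
proof -
  interpret primitive_root p g
    using assms by unfold_locales
  let ?N = "p - 1"
  define c where "c = (real p - 1) / (2 * (\<Prod>j=1..k. real (q j)))"
  \<comment> \<open>All terms of both inclusion-exclusions have the form \<open>U S\<close>, and by
    \<open>cardU\<close> their sizes depend on \<open>S\<close> only through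
    \<open>card S\<close>.\<close>
  define U where "U S = {a. a < ?N \<and> odd a \<and> (\<forall>t\<in>S. unit_exp (int a + t))}" for S
  have cardU: "real (card (U S)) = c * (\<Prod>j=1..k. real (q j) - real (card S))" if "S \<subseteq> {-2, 0, 2}" for S
    using card_odd_all_coprime[OF _ assms(3,4,5,6) that] prime_gt_0_nat[OF assms(1)]
    unfolding U_def unit_exp_def c_def by (simp add: of_nat_diff)
  have finU: "finite (U S)" for S
    unfolding U_def by simp
  have U_insert: "{a \<in> U S. unit_exp (int a + t)} = U (insert t S)" for S t
    unfolding U_def by auto
  have U_insert2: "{a \<in> U S. unit_exp (int a + t) \<and> unit_exp (int a + u)} = U (insert t (insert u S))"
    for S t u
    unfolding U_def by auto
  have neither: "real (card {a \<in> U S. \<not> unit_exp (int a + t) \<and> \<not> unit_exp (int a + u)})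
    = real (card (U S)) - real (card (U (insert t S))) - real (card (U (insert u S)))
      + real (card (U (insert t (insert u S))))" for S t u
    unfolding card_neither[OF finU] U_insert U_insert2 by (rule refl)
  \<comment> \<open>The base set \<open>U {0}\<close> consists of the unit exponents, as these are
    odd. The terms have one, two, two and three shifts.\<close>
  have "card (missing_gens p g) = card {a \<in> U {0}. \<not> unit_exp (int a + -2) \<and> \<not> unit_exp (int a + 2)}"
    unfolding card_missing_gens U_def
    by (intro arg_cong[where f = card] Collect_cong) (auto dest: unit_exp_imp_odd)
  then have "real (card (missing_gens p g))
    = real (card (U {0})) - real (card (U {-2, 0})) - real (card (U {2, 0})) + real (card (U {-2, 2, 0}))"
    by (simp only: neither)
  \<comment> \<open>Here the base set \<open>U {}\<close> is all odd \<open>a\<close> below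
    \<open>p - 1\<close>, and the terms have zero, one, one and two shifts.\<close>
  moreover have "card (NI_set p g) = card {a \<in> U {}. \<not> unit_exp (int a + 0) \<and> \<not> unit_exp (int a + -2)}"
    unfolding card_NI_set U_def
    by (intro arg_cong[where f = card] Collect_cong) auto
  then have "real (card (NI_set p g))
    = real (card (U {})) - real (card (U {0})) - real (card (U {-2})) + real (card (U {0, -2}))"
    by (simp only: neither)
  ultimately show ?thesis
    unfolding c_def[symmetric] by (simp add: cardU algebra_simps)
qed

end
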